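(* Let $\alpha>0$ and let $F$ be a distribution function on $\mathbb{R}$, with tail $\bar F=1-F$. The following statements are equivalent: (i) $F$ is in the free max-domain of attraction of the Pareto distribution with exponent $\alpha$, i.e. of the distribution function equal to $(1-x^{-\alpha})_+$ for $x>0$ and $0$ for $x\le 0$. (ii) $F$ is in the classical max-domain of attraction of the Fréchet distribution $\Phi_\alpha$, where $\Phi_\alpha(x)=\exp(-x^{-\alpha})$ for $x>0$ and $\Phi_\alpha(x)=0$ for $x\le0$. (iii) $\bar F$ is $-\alpha$-regularly varying at $\infty$, i.e. $\lim_{t\to\infty}\bar F(tx)/\bar F(t)=x^{-\alpha}$ for all $x>0$ (in particular $\bar F(t)>0$ for all $t$). Moreover, when these hold, the normalization constants in both (i) and (ii) can be chosen of the form $a_n=u_n$, $b_n=0$ (for all sufficiently large $n$), where $u_n=\inf\{t\in\mathbb{R}:\bar F(t)<n^{-1}\}$.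
   Context: A distribution function on $\mathbb{R}$ is $F(t)=\mu((-\infty,t])$ for a Borel probability measure $\mu$ on $\mathbb{R}$. Write $u_+=\max(u,0)$. For distribution functions $F,G$ put $F\veebar G=(F+G-1)_+$ (upper extremal free convolution); its $n$-fold iterate is $F^{\veebar n}=(nF-(n-1))_+$, equivalently $1-F^{\veebar n}=\min(n(1-F),1)$. $F$ is in the free max-domain of attraction of a distribution function $G$ if there exist normalization constants $a_n,b_n\in\mathbb{R}$, $a_n>0$, such that $F^{\veebar n}(a_nx+b_n)\to G(x)$ as $n\to\infty$ at every continuity point $x$ of $G$. $F$ is in the classical max-domain of attraction of $G$ if there exist normalization constants $a_n,b_n\in\mathbb{R}$, $a_n>0$, such that $F(a_nx+b_n)^n\to G(x)$ at every continuity point $x$ of $G$. *)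

theory Defs
  imports "HOL-Probability.Probability"
begin

definition distribution_function :: "(real \<Rightarrow> real) \<Rightarrow> bool" where
  "distribution_function F \<longleftrightarrow> (\<exists>M. real_distribution M \<and> F = cdf M)"

definition upper_free_conv :: "(real \<Rightarrow> real) \<Rightarrow> (real \<Rightarrow> real) \<Rightarrow> real \<Rightarrow> real" where
  "upper_free_conv F G = (\<lambda>t. max (F t + G t - 1) 0)"

text \<open>The recursion starts from the constant function 1, which is neutral for the
  convolution of nonnegative functions; so the first iterate of \<open>F\<close> is \<open>F\<close> itself.\<close>

primrec upper_free_conv_power :: "(real \<Rightarrow> real) \<Rightarrow> nat \<Rightarrow> real \<Rightarrow> real" where
  "upper_free_conv_power F 0 = (\<lambda>t. 1)"
| "upper_free_conv_power F (Suc n) = upper_free_conv (upper_free_conv_power F n) F"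

lemma distribution_function_bounds:
  assumes "distribution_function F"
  shows "0 \<le> F t" "F t \<le> 1"
proof -
  obtain M where M: "real_distribution M" and F: "F = cdf M"
    using assms by (auto simp: distribution_function_def)
  interpret real_distribution M by (fact M)
  show "0 \<le> F t" "F t \<le> 1"
    by (simp_all add: F cdf_nonneg cdf_bounded_prob)
qed

lemma upper_free_conv_power_eq:
  assumes "distribution_function F"
  shows "upper_free_conv_power F n t = max (real n * F t - (real n - 1)) 0"
proof (induction n)
  case (Suc n)
  then show ?case
    using distribution_function_bounds[OF assms, of t]
    by (auto simp: upper_free_conv_def max_def algebra_simps)
qed simp

lemma upper_free_conv_power_tail:
  assumes "distribution_function F"
  shows "1 - upper_free_conv_power F n t = min (real n * (1 - F t)) 1"
  by (auto simp: upper_free_conv_power_eq[OF assms] max_def min_def algebra_simps)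

definition free_max_normalization ::
  "(real \<Rightarrow> real) \<Rightarrow> (real \<Rightarrow> real) \<Rightarrow> (nat \<Rightarrow> real) \<Rightarrow> (nat \<Rightarrow> real) \<Rightarrow> bool" where
  "free_max_normalization F G a b \<longleftrightarrow> (\<forall>n\<ge>1. a n > 0) \<and>
     (\<forall>x. isCont G x \<longrightarrow> (\<lambda>n. upper_free_conv_power F n (a n * x + b n)) \<longlonglongrightarrow> G x)"

definition classical_max_normalization ::
  "(real \<Rightarrow> real) \<Rightarrow> (real \<Rightarrow> real) \<Rightarrow> (nat \<Rightarrow> real) \<Rightarrow> (nat \<Rightarrow> real) \<Rightarrow> bool" where
  "classical_max_normalization F G a b \<longleftrightarrow> (\<forall>n\<ge>1. a n > 0) \<and>
     (\<forall>x. isCont G x \<longrightarrow> (\<lambda>n. F (a n * x + b n) ^ n) \<longlonglongrightarrow> G x)"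

definition in_free_max_domain :: "(real \<Rightarrow> real) \<Rightarrow> (real \<Rightarrow> real) \<Rightarrow> bool" where
  "in_free_max_domain F G \<longleftrightarrow> (\<exists>a b. free_max_normalization F G a b)"

definition in_classical_max_domain :: "(real \<Rightarrow> real) \<Rightarrow> (real \<Rightarrow> real) \<Rightarrow> bool" where
  "in_classical_max_domain F G \<longleftrightarrow> (\<exists>a b. classical_max_normalization F G a b)"

definition pareto_df :: "real \<Rightarrow> real \<Rightarrow> real" where
  "pareto_df \<alpha> x = (if x > 0 then max (1 - x powr (-\<alpha>)) 0 else 0)"

definition frechet_df :: "real \<Rightarrow> real \<Rightarrow> real" where
  "frechet_df \<alpha> x = (if x > 0 then exp (- (x powr (-\<alpha>))) else 0)"

definition tail :: "(real \<Rightarrow> real) \<Rightarrow> real \<Rightarrow> real" where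
  "tail F t = 1 - F t"

text \<open>Division by zero does not make this condition spuriously true: a function that vanishes
  at arbitrarily large arguments violates it at \<open>x = 1\<close> (next lemma).\<close>

definition regularly_varying :: "(real \<Rightarrow> real) \<Rightarrow> real \<Rightarrow> bool" where
  "regularly_varying f \<rho> \<longleftrightarrow>
     (\<forall>x>0. ((\<lambda>t. f (t * x) / f t) \<longlongrightarrow> x powr \<rho>) at_top)"

lemma regularly_varying_eventually_nonzero:
  assumes "regularly_varying f \<rho>"
  shows "\<forall>\<^sub>F t in at_top. f t \<noteq> 0"
proof -
  have "((\<lambda>t. f t / f t) \<longlongrightarrow> 1) at_top"
    using assms unfolding regularly_varying_def by (auto dest: spec[where x = 1])
  then have "\<forall>\<^sub>F t in at_top. f t / f t > 0"
    by (rule order_tendstoD) simp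
  then show ?thesis
    by eventually_elim auto
qed

text \<open>For \<open>n \<ge> 2\<close> and \<open>F\<close> a distribution function the set is nonempty and bounded below, so
  \<open>Inf\<close> is the true infimum; for \<open>n \<le> 1\<close> the value may be meaningless.\<close>

definition tail_quantile :: "(real \<Rightarrow> real) \<Rightarrow> nat \<Rightarrow> real" where
  "tail_quantile F n = Inf {t. tail F t < 1 / real n}"

end

theory Submission
  imports Defs "HOL-Real_Asymp.Real_Asymp"
begin

text \<open>
  Both domains of attraction are governed by the same limit. Writing \<open>T\<close> for the tail of \<open>F\<close>, the
  free iterate at \<open>t\<close> is \<open>max (1 - n * T t) 0\<close>, while the classical power \<open>F t ^ n\<close> behaves like
  \<open>exp (- n * T t)\<close>. The Pareto limit therefore says that \<open>n * T (a n * x + b n)\<close> tends to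
  \<open>x powr -\<alpha>\<close> wherever this value is below 1, that is for \<open>x > 1\<close>, and the Frechet limit says so
  for every \<open>x > 0\<close>. Only the common part \<open>x > 1\<close>, named \<open>tail_normalized\<close>, is used to reach regular
  variation, so one argument serves both implications.

  The difficulty in that argument is the centering \<open>b\<close>. As \<open>T\<close> is monotone and the limit is strictly
  decreasing, the position of a point \<open>z\<close> relative to \<open>a n\<close>, \<open>b n\<close> can be read off from \<open>n * T z\<close>
  (\<open>tail_normalized_inverse\<close>). Comparing the normalizations at \<open>n\<close> and at \<open>n div 2\<close> in this way gives
  \<open>a (n div 2) / a n \<longlonglongrightarrow> 2 powr (-1/\<alpha>) < 1\<close> and \<open>(b (n div 2) - b n) / a n \<longlonglongrightarrow> 0\<close>. The quotient
  \<open>b n / a n\<close> is thus a contraction of its value at \<open>n div 2\<close> up to a vanishing error, and tends to 0;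
  likewise \<open>1 / a n\<close>. Hence \<open>b\<close> may be dropped and \<open>T\<close> never vanishes. For large real \<open>t\<close>, choosing
  the integer \<open>n\<close> near \<open>K powr -\<alpha> / T t\<close> forces \<open>t / a n\<close> to tend to \<open>K\<close>, and
  \<open>T (t * x) / T t\<close> becomes a quotient of two known limits; the factor \<open>K\<close> is chosen so large that
  both arguments, \<open>K\<close> and \<open>K * x\<close>, exceed 1.

  Conversely, if \<open>T\<close> is regularly varying, then \<open>n * T\<close> is at least 1 to the left of the quantile \<open>u n\<close>
  and less than 1 to its right, so regular variation near \<open>x = 1\<close> gives \<open>n * T (u n) \<longlonglongrightarrow> 1\<close> and hence
  \<open>n * T (u n * x) \<longlonglongrightarrow> x powr -\<alpha>\<close> for all \<open>x > 0\<close>. Monotonicity turns this into divergence for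
  \<open>x \<le> 0\<close>, and both max-limits follow with the constants \<open>u n\<close> and 0.
\<close>

section \<open>Tails under affine normalization\<close>

text \<open>
  The range \<open>x > 1\<close> is where the Pareto distribution function is positive. Elsewhere free
  convergence only bounds \<open>n * T\<close> from below, asymptotically by 1.
\<close>

definition tail_normalized ::
  "(real \<Rightarrow> real) \<Rightarrow> real \<Rightarrow> (nat \<Rightarrow> real) \<Rightarrow> (nat \<Rightarrow> real) \<Rightarrow> bool" where
  "tail_normalized T \<alpha> a b \<longleftrightarrow> (\<forall>n\<ge>1. a n > 0) \<and>
     (\<forall>x>1. (\<lambda>n. real n * T (a n * x + b n)) \<longlonglongrightarrow> x powr (-\<alpha>))"

text \<open>
  Indices are allowed to run along an arbitrary filter, since they will be both halved integers
  and integers depending on a real argument.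
\<close>

lemma tail_normalizedD:
  assumes "tail_normalized T \<alpha> a b" "filterlim N sequentially G"
  shows "\<forall>\<^sub>F i in G. a (N i) > 0"
    and "x > 1 \<Longrightarrow> ((\<lambda>i. real (N i) * T (a (N i) * x + b (N i))) \<longlongrightarrow> x powr (-\<alpha>)) G"
proof -
  have "\<forall>\<^sub>F i in G. N i \<ge> 1"
    using assms(2) by (simp add: filterlim_at_top)
  then show "\<forall>\<^sub>F i in G. a (N i) > 0"
    using assms(1) by (auto simp: tail_normalized_def elim: eventually_mono)
  show "x > 1 \<Longrightarrow> ((\<lambda>i. real (N i) * T (a (N i) * x + b (N i))) \<longlongrightarrow> x powr (-\<alpha>)) G"
    using assms filterlim_compose[of "\<lambda>n. real n * T (a n * x + b n)"]
    unfolding tail_normalized_def by blast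
qed

text \<open>
  A monotone function whose rescalings converge to a strictly decreasing limit can be inverted
  asymptotically: if \<open>z\<close> stayed below \<open>a * x + b\<close> for some \<open>x < y\<close>, then \<open>n * T z\<close> would be at least
  about \<open>x powr -\<alpha>\<close>, which exceeds its limit \<open>y powr -\<alpha>\<close>; similarly from above.
\<close>

lemma tail_normalized_inverse:
  assumes T: "antimono T" and \<alpha>: "\<alpha> > 0" and norm: "tail_normalized T \<alpha> a b"
    and N: "filterlim N sequentially G" and y: "y > 1"
    and lim: "((\<lambda>i. real (N i) * T (z i)) \<longlongrightarrow> y powr (-\<alpha>)) G"
  shows "((\<lambda>i. (z i - b (N i)) / a (N i)) \<longlongrightarrow> y) G"
proof (rule order_tendstoI)
  fix l assume "l < y"
  then obtain x where x: "max l 1 < x" "x < y"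
    using dense[of "max l 1" y] y by auto
  obtain c where c: "y powr (-\<alpha>) < c" "c < x powr (-\<alpha>)"
    using dense powr_less_mono2_neg[of "-\<alpha>" x y] \<alpha> x by auto
  have "\<forall>\<^sub>F i in G. real (N i) * T (a (N i) * x + b (N i)) > c"
    using order_tendstoD(1)[OF tail_normalizedD(2)[OF norm N, of x] c(2)] x by simp
  with order_tendstoD(2)[OF lim c(1)] tail_normalizedD(1)[OF norm N]
  show "\<forall>\<^sub>F i in G. l < (z i - b (N i)) / a (N i)"
  proof eventually_elim
    case (elim i)
    then have "real (N i) * T (z i) < real (N i) * T (a (N i) * x + b (N i))" by simp
    then have "T (z i) < T (a (N i) * x + b (N i))"
      by (simp add: mult_less_cancel_left)
    then have "z i > a (N i) * x + b (N i)"
      using antimonoD[OF T, of "z i"] by (meson leD le_less_linear)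
    with elim have "x < (z i - b (N i)) / a (N i)"
      by (simp add: field_simps)
    with x show ?case by simp
  qed
next
  fix h assume "y < h"
  then obtain x where x: "y < x" "x < h" using dense by blast
  obtain c where c: "x powr (-\<alpha>) < c" "c < y powr (-\<alpha>)"
    using dense powr_less_mono2_neg[of "-\<alpha>" y x] \<alpha> x y by auto
  have "\<forall>\<^sub>F i in G. real (N i) * T (a (N i) * x + b (N i)) < c"
    using order_tendstoD(2)[OF tail_normalizedD(2)[OF norm N, of x] c(1)] x y by simp
  with order_tendstoD(1)[OF lim c(2)] tail_normalizedD(1)[OF norm N]
  show "\<forall>\<^sub>F i in G. (z i - b (N i)) / a (N i) < h"
  proof eventually_elim
    case (elim i)
    then have "real (N i) * T (a (N i) * x + b (N i)) < real (N i) * T (z i)" by simp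
    then have "T (a (N i) * x + b (N i)) < T (z i)"
      by (simp add: mult_less_cancel_left)
    then have "z i < a (N i) * x + b (N i)"
      using antimonoD[OF T, of _ "z i"] by (meson leD le_less_linear)
    with elim have "(z i - b (N i)) / a (N i) < x"
      by (simp add: field_simps)
    with x show ?case by simp
  qed
qed

text \<open>
  Pointwise convergence of monotone functions to a continuous limit is locally uniform, so the
  argument may move with the index.
\<close>

lemma tail_normalized_moving_argument:
  assumes T: "antimono T" and \<alpha>: "\<alpha> > 0" and norm: "tail_normalized T \<alpha> a b"
    and N: "filterlim N sequentially G" and y: "y > 1" and lim: "(v \<longlongrightarrow> y) G"
  shows "((\<lambda>i. real (N i) * T (a (N i) * v i + b (N i))) \<longlongrightarrow> y powr (-\<alpha>)) G"
proof (rule order_tendstoI)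
  have cont: "((\<lambda>x. x powr (-\<alpha>)) \<longlongrightarrow> y powr (-\<alpha>)) (at y within S)" for S
    using y by (intro tendsto_intros) auto
  {
    fix l assume "l < y powr (-\<alpha>)"
    with cont[of "{y<..}"] have "\<forall>\<^sub>F x in at_right y. l < x powr (-\<alpha>)"
      by (rule order_tendstoD(1))
    from eventually_happens'[OF _ eventually_conj[OF eventually_at_right_less this]]
    obtain x where x: "y < x" "l < x powr (-\<alpha>)" by auto
    have "\<forall>\<^sub>F i in G. real (N i) * T (a (N i) * x + b (N i)) > l"
      using order_tendstoD(1)[OF tail_normalizedD(2)[OF norm N, of x] x(2)] x y by simp
    with order_tendstoD(2)[OF lim x(1)] tail_normalizedD(1)[OF norm N]
    show "\<forall>\<^sub>F i in G. l < real (N i) * T (a (N i) * v i + b (N i))"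
    proof eventually_elim
      case (elim i)
      then have "a (N i) * v i + b (N i) \<le> a (N i) * x + b (N i)" by simp
      from mult_left_mono[OF antimonoD[OF T this], of "real (N i)"] elim
      show ?case by simp
    qed
  next
    fix h assume "y powr (-\<alpha>) < h"
    with cont[of "{..<y}"] have "\<forall>\<^sub>F x in at_left y. x powr (-\<alpha>) < h"
      by (rule order_tendstoD(2))
    from eventually_happens'[OF _ eventually_conj[OF eventually_at_left_real[OF y] this]]
    obtain x where x: "1 < x" "x < y" "x powr (-\<alpha>) < h" by auto
    have "\<forall>\<^sub>F i in G. real (N i) * T (a (N i) * x + b (N i)) < h"
      using order_tendstoD(2)[OF tail_normalizedD(2)[OF norm N, of x] x(3)] x by simp
    with order_tendstoD(1)[OF lim x(2)] tail_normalizedD(1)[OF norm N]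
    show "\<forall>\<^sub>F i in G. real (N i) * T (a (N i) * v i + b (N i)) < h"
    proof eventually_elim
      case (elim i)
      then have "a (N i) * x + b (N i) \<le> a (N i) * v i + b (N i)" by simp
      from mult_left_mono[OF antimonoD[OF T this], of "real (N i)"] elim
      show ?case by simp
    qed
  }
qed

section \<open>Eliminating the centering constants\<close>

text \<open>
  After \<open>k\<close> halvings the initial bound has been multiplied by \<open>c ^ k\<close>, while the errors collected on
  the way form a geometric series.
\<close>

lemma halving_contraction_tendsto_0:
  fixes s e :: "nat \<Rightarrow> real"
  assumes c: "0 \<le> c" "c < 1" and s: "\<And>n. 0 \<le> s n" and e: "e \<longlonglongrightarrow> 0"
    and rec: "\<forall>\<^sub>F n in sequentially. s n \<le> c * s (n div 2) + e n"
  shows "s \<longlonglongrightarrow> 0"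
proof (rule order_tendstoI)
  fix l :: real assume "l < 0"
  then show "\<forall>\<^sub>F n in sequentially. l < s n"
    using s by (intro always_eventually) (meson less_le_trans)
next
  fix h :: real assume "0 < h"
  define \<epsilon> where "\<epsilon> = h / 2"
  have \<epsilon>: "\<epsilon> > 0" using \<open>0 < h\<close> by (simp add: \<epsilon>_def)
  have "\<forall>\<^sub>F n in sequentially. e n < (1 - c) * \<epsilon>"
    using e c \<epsilon> by (intro order_tendstoD(2)) auto
  with rec have "\<forall>\<^sub>F n in sequentially. s n \<le> c * s (n div 2) + (1 - c) * \<epsilon>"
    by eventually_elim simp
  then obtain N0 where N0: "\<And>n. n \<ge> N0 \<Longrightarrow> s n \<le> c * s (n div 2) + (1 - c) * \<epsilon>"
    by (auto simp: eventually_sequentially)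
  define N where "N = max N0 1"
  have N: "s n \<le> c * s (n div 2) + (1 - c) * \<epsilon>" if "n \<ge> N" for n
    using N0 that by (simp add: N_def)
  \<comment> \<open>The recursion preserves the bound \<open>M\<close> because \<open>\<epsilon> \<le> M\<close>.\<close>
  define M where "M = max \<epsilon> (Max (s ` {..N}))"
  have M: "s n \<le> M" for n
  proof (induction n rule: less_induct)
    case (less n)
    show ?case
    proof (cases "n \<ge> N")
      case True
      then have "n div 2 < n" by (simp add: N_def)
      have "s n \<le> c * s (n div 2) + (1 - c) * \<epsilon>" using N True .
      also have "\<dots> \<le> c * M + (1 - c) * M"
        using c less[OF \<open>n div 2 < n\<close>] by (intro add_mono mult_left_mono) (auto simp: M_def)
      finally show ?thesis by (simp add: algebra_simps)
    next
      case False
      then have "s n \<le> Max (s ` {..N})" by (intro Max_ge) auto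
      then show ?thesis by (simp add: M_def)
    qed
  qed
  have iter: "s n \<le> \<epsilon> + c ^ k * M" if "n \<ge> 2 ^ k * N" for n k
    using that
  proof (induction k arbitrary: n)
    case 0
    then show ?case using M[of n] \<epsilon> by simp
  next
    case (Suc k)
    have "1 * N \<le> 2 ^ Suc k * N" by (intro mult_right_mono) auto
    with Suc.prems have "N \<le> n" by linarith
    then have "s n \<le> c * s (n div 2) + (1 - c) * \<epsilon>" by (rule N)
    also have "\<dots> \<le> c * (\<epsilon> + c ^ k * M) + (1 - c) * \<epsilon>"
      using c Suc.prems by (intro add_mono mult_left_mono Suc.IH) auto
    finally show ?case by (simp add: algebra_simps)
  qed
  have "(\<lambda>k. c ^ k * M) \<longlonglongrightarrow> 0 * M"
    using c by (intro tendsto_intros LIMSEQ_power_zero) auto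
  then have "\<forall>\<^sub>F k in sequentially. c ^ k * M < \<epsilon>"
    using \<epsilon> by (intro order_tendstoD(2)) auto
  then obtain k where "c ^ k * M < \<epsilon>"
    by (auto simp: eventually_sequentially)
  with iter[of k] have "s n < h" if "n \<ge> 2 ^ k * N" for n
    using that by (fastforce simp: \<epsilon>_def)
  then show "\<forall>\<^sub>F n in sequentially. s n < h"
    by (auto simp: eventually_sequentially)
qed

text \<open>
  The points \<open>a (n div 2) * x + b (n div 2)\<close> are calibrated at level \<open>n div 2\<close>; at level \<open>n\<close> their
  tail limit is twice as large, which corresponds to the argument \<open>x * 2 powr (-1/\<alpha>)\<close>. This is a
  relation that is affine in \<open>x\<close>, and two values of \<open>x\<close> determine its slope and its intercept.
\<close>

lemma tail_normalized_halving:
  assumes T: "antimono T" and \<alpha>: "\<alpha> > 0" and norm: "tail_normalized T \<alpha> a b"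
  shows "(\<lambda>n. a (n div 2) / a n) \<longlonglongrightarrow> (1/2) powr (1/\<alpha>)"
    and "(\<lambda>n. (b (n div 2) - b n) / a n) \<longlonglongrightarrow> 0"
proof -
  define q :: real where "q = (1/2) powr (1/\<alpha>)"
  have q: "q > 0" "q powr (-\<alpha>) = 2"
    using \<alpha> by (simp_all add: q_def powr_powr powr_minus powr_divide)
  have half: "filterlim (\<lambda>n::nat. n div 2) sequentially sequentially"
    by real_asymp
  have ratio: "(\<lambda>n. real n / real (n div 2)) \<longlonglongrightarrow> 2"
    by real_asymp
  have lim: "(\<lambda>n. (a (n div 2) * x + b (n div 2) - b n) / a n) \<longlonglongrightarrow> x * q"
    if x: "x > 1" "x * q > 1" for x
  proof (rule tail_normalized_inverse[OF T \<alpha> norm filterlim_ident x(2)])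
    have "(\<lambda>n. real n / real (n div 2) *
        (real (n div 2) * T (a (n div 2) * x + b (n div 2)))) \<longlonglongrightarrow> 2 * x powr (-\<alpha>)"
      using x by (intro tendsto_mult ratio tail_normalizedD(2)[OF norm half])
    also have "2 * x powr (-\<alpha>) = (x * q) powr (-\<alpha>)"
      using x q by (simp add: powr_mult)
    finally show "(\<lambda>n. real n * T (a (n div 2) * x + b (n div 2))) \<longlonglongrightarrow> (x * q) powr (-\<alpha>)"
    proof (rule Lim_transform_eventually)
      show "\<forall>\<^sub>F n in sequentially. real n / real (n div 2) *
        (real (n div 2) * T (a (n div 2) * x + b (n div 2))) =
        real n * T (a (n div 2) * x + b (n div 2))"
        using eventually_ge_at_top[of 2] by eventually_elim auto
    qed
  qed
  \<comment> \<open>Both \<open>x\<close> and \<open>x * q\<close> have to lie beyond 1.\<close>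
  define x where "x = max 1 (1/q) + 1"
  have x: "x > 1" "x * q > 1" "x + 1 > 1" "(x + 1) * q > 1"
  proof -
    show "x > 1" "x + 1 > 1" by (auto simp: x_def)
    have "1 / q < x" by (auto simp: x_def)
    then show "x * q > 1" using q by (simp add: field_simps)
    then show "(x + 1) * q > 1" using q by (simp add: algebra_simps)
  qed
  have "(\<lambda>n. (a (n div 2) * (x + 1) + b (n div 2) - b n) / a n -
      (a (n div 2) * x + b (n div 2) - b n) / a n) \<longlonglongrightarrow> (x + 1) * q - x * q"
    by (intro tendsto_diff lim x)
  then have a: "(\<lambda>n. a (n div 2) / a n) \<longlonglongrightarrow> q"
    by (simp add: diff_divide_distrib [symmetric] algebra_simps)
  then show "(\<lambda>n. a (n div 2) / a n) \<longlonglongrightarrow> (1/2) powr (1/\<alpha>)" by (simp add: q_def)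
  have "(\<lambda>n. (a (n div 2) * x + b (n div 2) - b n) / a n - a (n div 2) / a n * x)
      \<longlonglongrightarrow> x * q - q * x"
    by (intro tendsto_diff tendsto_mult tendsto_const lim x a)
  then show "(\<lambda>n. (b (n div 2) - b n) / a n) \<longlonglongrightarrow> 0"
    by (simp add: diff_divide_distrib add_divide_distrib)
qed

text \<open>
  Both limits come from the halving recursion: \<open>b n / a n\<close> and \<open>1 / a n\<close> are the respective values at
  \<open>n div 2\<close> times \<open>a (n div 2) / a n\<close>, which is eventually less than a constant below 1, up to an
  error that vanishes in the limit.
\<close>

lemma tail_normalized_asymptotics:
  assumes T: "antimono T" and \<alpha>: "\<alpha> > 0" and norm: "tail_normalized T \<alpha> a b"
  shows "(\<lambda>n. b n / a n) \<longlonglongrightarrow> 0" and "filterlim a at_top sequentially"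
proof -
  define q :: real where "q = (1/2) powr (1/\<alpha>)"
  have "q < 1"
    using \<alpha> powr_less_mono2[of "1/\<alpha>" "1/2" 1] by (simp add: q_def)
  moreover have "q > 0" by (simp add: q_def)
  ultimately obtain c where c: "q < c" "c < 1" "0 \<le> c"
    using dense[of q 1] by force
  have half: "filterlim (\<lambda>n::nat. n div 2) sequentially sequentially"
    by real_asymp
  have bound: "\<forall>\<^sub>F n in sequentially. a (n div 2) / a n < c \<and> a n > 0 \<and> a (n div 2) > 0"
    using order_tendstoD(2)[OF tail_normalized_halving(1)[OF assms, folded q_def] c(1)]
      tail_normalizedD(1)[OF norm half] tail_normalizedD(1)[OF norm filterlim_ident]
    by eventually_elim auto
  have "(\<lambda>n. \<bar>b n / a n\<bar>) \<longlonglongrightarrow> 0"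
  proof (rule halving_contraction_tendsto_0[OF c(3,2)])
    show "(\<lambda>n. \<bar>(b (n div 2) - b n) / a n\<bar>) \<longlonglongrightarrow> 0"
      using tail_normalized_halving(2)[OF assms] by (rule tendsto_rabs_zero)
    show "\<forall>\<^sub>F n in sequentially. \<bar>b n / a n\<bar> \<le>
        c * \<bar>b (n div 2) / a (n div 2)\<bar> + \<bar>(b (n div 2) - b n) / a n\<bar>"
      using bound
    proof eventually_elim
      case (elim n)
      then have "b n / a n = a (n div 2) / a n * (b (n div 2) / a (n div 2)) - (b (n div 2) - b n) / a n"
        by (simp add: field_simps)
      also have "\<bar>\<dots>\<bar> \<le> \<bar>a (n div 2) / a n * (b (n div 2) / a (n div 2))\<bar> + \<bar>(b (n div 2) - b n) / a n\<bar>"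
        by (rule abs_triangle_ineq4)
      also have "\<bar>a (n div 2) / a n * (b (n div 2) / a (n div 2))\<bar> =
          a (n div 2) / a n * \<bar>b (n div 2) / a (n div 2)\<bar>"
        using elim by (simp add: abs_mult)
      also have "\<dots> \<le> c * \<bar>b (n div 2) / a (n div 2)\<bar>"
        using elim by (intro mult_right_mono) auto
      finally show ?case by simp
    qed
  qed simp
  then show "(\<lambda>n. b n / a n) \<longlonglongrightarrow> 0" by (rule tendsto_rabs_zero_cancel)
  have "(\<lambda>n. \<bar>inverse (a n)\<bar>) \<longlonglongrightarrow> 0"
  proof (rule halving_contraction_tendsto_0[OF c(3,2)])
    show "\<forall>\<^sub>F n in sequentially. \<bar>inverse (a n)\<bar> \<le> c * \<bar>inverse (a (n div 2))\<bar> + 0"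
      using bound
    proof eventually_elim
      case (elim n)
      then have "\<bar>inverse (a n)\<bar> = a (n div 2) / a n * \<bar>inverse (a (n div 2))\<bar>"
        by (simp add: field_simps)
      also have "\<dots> \<le> c * \<bar>inverse (a (n div 2))\<bar>"
        using elim by (intro mult_right_mono) auto
      finally show ?case by simp
    qed
  qed simp_all
  then have "(\<lambda>n. inverse (a n)) \<longlonglongrightarrow> 0" by (rule tendsto_rabs_zero_cancel)
  then have "filterlim (\<lambda>n. inverse (inverse (a n))) at_top sequentially"
    using tail_normalizedD(1)[OF norm filterlim_ident]
    by (intro filterlim_inverse_at_top) (auto elim: eventually_mono)
  then show "filterlim a at_top sequentially" by simp
qed

text \<open>
  Dropping \<open>b n\<close> moves the argument from \<open>x\<close> to \<open>x - b n / a n\<close>, which has the same limit.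
\<close>

lemma tail_normalized_uncentered:
  assumes T: "antimono T" and \<alpha>: "\<alpha> > 0" and norm: "tail_normalized T \<alpha> a b"
  shows "tail_normalized T \<alpha> a (\<lambda>_. 0)"
proof -
  have "(\<lambda>n. real n * T (a n * x)) \<longlonglongrightarrow> x powr (-\<alpha>)" if x: "x > 1" for x
  proof -
    have "(\<lambda>n. x - b n / a n) \<longlonglongrightarrow> x - 0"
      by (intro tendsto_diff tendsto_const tail_normalized_asymptotics(1)[OF assms])
    then have "(\<lambda>n. real n * T (a n * (x - b n / a n) + b n)) \<longlonglongrightarrow> x powr (-\<alpha>)"
      using tail_normalized_moving_argument[OF assms filterlim_ident x] by simp
    then show ?thesis
      by (rule Lim_transform_eventually)
        (use tail_normalizedD(1)[OF norm filterlim_ident] in eventually_elim, simp add: field_simps)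
  qed
  with norm show ?thesis by (simp add: tail_normalized_def)
qed

section \<open>From normalized tails to regular variation\<close>

text \<open>
  The limit \<open>2 powr -\<alpha>\<close> is positive, so \<open>T\<close> is eventually positive at the points \<open>a n * 2\<close>, and these
  tend to infinity.
\<close>

lemma tail_normalized_imp_pos:
  assumes T: "antimono T" and \<alpha>: "\<alpha> > 0" and norm: "tail_normalized T \<alpha> a b"
  shows "T t > 0"
proof -
  have 0: "tail_normalized T \<alpha> a (\<lambda>_. 0)" by (rule tail_normalized_uncentered[OF assms])
  have "\<forall>\<^sub>F n in sequentially. a n \<ge> \<bar>t\<bar>"
    using tail_normalized_asymptotics(2)[OF assms] by (simp add: filterlim_at_top)
  moreover have "\<forall>\<^sub>F n in sequentially. real n * T (a n * 2) > 0"
    using order_tendstoD(1)[OF tail_normalizedD(2)[OF 0 filterlim_ident, of 2], of 0] by simp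
  ultimately have "\<forall>\<^sub>F n in sequentially. T t > 0"
  proof eventually_elim
    case (elim n)
    then have "t \<le> a n * 2" by simp
    from antimonoD[OF T this] elim show ?case
      by (auto simp: zero_less_mult_iff)
  qed
  then show ?thesis by simp
qed

text \<open>
  The passage from integers \<open>n\<close> to real \<open>t\<close> goes through the tail itself: an integer \<open>N t\<close> close to
  \<open>K powr -\<alpha> / T t\<close> makes \<open>N t * T t\<close> converge to \<open>K powr -\<alpha>\<close>, and inversion then shows that \<open>t\<close> is
  asymptotic to \<open>a (N t) * K\<close>.
\<close>

lemma tail_normalized_imp_regularly_varying:
  assumes T: "antimono T" and \<alpha>: "\<alpha> > 0" and norm: "tail_normalized T \<alpha> a b"
    and T0: "(T \<longlongrightarrow> 0) at_top"
  shows "regularly_varying T (-\<alpha>)"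
  unfolding regularly_varying_def
proof (intro allI impI)
  fix x :: real assume x: "x > 0"
  have 0: "tail_normalized T \<alpha> a (\<lambda>_. 0)" by (rule tail_normalized_uncentered[OF T \<alpha> norm])
  have pos: "T t > 0" for t by (rule tail_normalized_imp_pos[OF T \<alpha> norm])
  \<comment> \<open>The arguments \<open>K\<close> and \<open>K * x\<close> both lie in the range where the limit of the tail is known.\<close>
  define K where "K = max 1 (1/x) + 1"
  have K: "K > 1" by (auto simp: K_def)
  have "1/x < K" by (auto simp: K_def)
  then have Kx: "K * x > 1" using x by (simp add: field_simps)
  define c where "c = K powr (-\<alpha>)"
  have c: "c > 0" using K by (simp add: c_def)
  define N where "N = (\<lambda>t. nat \<lfloor>c / T t\<rfloor>)"
  have N_bounds: "real (N t) \<le> c / T t" "c / T t - 1 \<le> real (N t)" for t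
  proof -
    have "c / T t > 0" using pos c by simp
    then have "real (N t) = of_int \<lfloor>c / T t\<rfloor>" by (simp add: N_def)
    then show "real (N t) \<le> c / T t" "c / T t - 1 \<le> real (N t)" by linarith+
  qed
  have "filterlim (\<lambda>t. inverse (T t)) at_top at_top"
    using T0 pos by (intro filterlim_inverse_at_top) auto
  then have "filterlim (\<lambda>t. c * inverse (T t)) at_top at_top"
    using c by (intro filterlim_tendsto_pos_mult_at_top[OF tendsto_const])
  then have "filterlim (\<lambda>t. -1 + c * inverse (T t)) at_top at_top"
    by (intro filterlim_tendsto_add_at_top[OF tendsto_const])
  then have "filterlim (\<lambda>t. real (N t)) at_top at_top"
    by (rule filterlim_at_top_mono) (use N_bounds in \<open>auto simp: field_simps\<close>)
  then have N: "filterlim N sequentially at_top"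
    by (simp add: filterlim_sequentially_iff_filterlim_real)
  have NT: "((\<lambda>t. real (N t) * T t) \<longlongrightarrow> c) at_top"
  proof (rule tendsto_sandwich)
    show "((\<lambda>t. c - T t) \<longlongrightarrow> c) at_top"
      using tendsto_diff[OF tendsto_const T0, of c] by simp
    have "c - T t \<le> real (N t) * T t \<and> real (N t) * T t \<le> c" for t
      using N_bounds[of t] pos[of t] by (simp add: field_simps)
    then show "\<forall>\<^sub>F t in at_top. c - T t \<le> real (N t) * T t"
      "\<forall>\<^sub>F t in at_top. real (N t) * T t \<le> c" by auto
  qed simp
  have "((\<lambda>t. (t - 0) / a (N t)) \<longlongrightarrow> K) at_top"
    using NT by (intro tail_normalized_inverse[OF T \<alpha> 0 N K]) (simp add: c_def)
  then have "((\<lambda>t. t / a (N t) * x) \<longlongrightarrow> K * x) at_top"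
    by (intro tendsto_mult) auto
  then have "((\<lambda>t. real (N t) * T (a (N t) * (t / a (N t) * x) + 0)) \<longlongrightarrow> (K * x) powr (-\<alpha>)) at_top"
    by (rule tail_normalized_moving_argument[OF T \<alpha> 0 N Kx])
  then have "((\<lambda>t. real (N t) * T (t * x)) \<longlongrightarrow> (K * x) powr (-\<alpha>)) at_top"
    by (rule Lim_transform_eventually)
      (use tail_normalizedD(1)[OF norm N] in eventually_elim, simp add: field_simps)
  then have "((\<lambda>t. real (N t) * T (t * x) / (real (N t) * T t)) \<longlongrightarrow> (K * x) powr (-\<alpha>) / c) at_top"
    using NT c by (intro tendsto_divide) auto
  also have "(K * x) powr (-\<alpha>) / c = x powr (-\<alpha>)"
    using K x by (simp add: c_def powr_mult)
  finally show "((\<lambda>t. T (t * x) / T t) \<longlongrightarrow> x powr (-\<alpha>)) at_top"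
  proof (rule Lim_transform_eventually)
    have "\<forall>\<^sub>F t in at_top. N t \<ge> 1" using N by (simp add: filterlim_at_top)
    then show "\<forall>\<^sub>F t in at_top. real (N t) * T (t * x) / (real (N t) * T t) = T (t * x) / T t"
      by eventually_elim auto
  qed
qed

section \<open>Regularly varying tails at their quantiles\<close>

lemma regularly_varying_imp_pos:
  assumes T: "antimono T" and nonneg: "\<And>t. 0 \<le> T t" and rv: "regularly_varying T \<rho>"
  shows "T t > 0"
proof -
  have "\<forall>\<^sub>F s::real in at_top. T t > 0"
    using regularly_varying_eventually_nonzero[OF rv] eventually_ge_at_top[of t]
  proof eventually_elim
    case (elim s)
    then show ?case using antimonoD[OF T, of t s] nonneg[of s] by simp
  qed
  then show ?thesis by simp
qed

lemma quantile_bounds: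
  fixes T :: "real \<Rightarrow> real"
  assumes T: "antimono T" and T0: "(T \<longlongrightarrow> 0) at_top" and l: "0 < l" "l \<le> T s"
  defines "u \<equiv> Inf {t. T t < l}"
  shows "s \<le> u" and "t < u \<Longrightarrow> l \<le> T t" and "u < t \<Longrightarrow> T t < l"
proof -
  have ne: "{t. T t < l} \<noteq> {}"
    using eventually_happens'[OF _ order_tendstoD(2)[OF T0 l(1)]] by auto
  have lb: "s \<le> t" if "T t < l" for t
    using antimonoD[OF T, of t s] l that by force
  then have bdd: "bdd_below {t. T t < l}" by (auto intro!: bdd_belowI[of _ s])
  show "s \<le> u" unfolding u_def using ne lb by (auto intro: cInf_greatest)
  show "l \<le> T t" if "t < u"
    using that cInf_lower[OF _ bdd, of t] by (force simp: u_def)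
  show "T t < l" if "u < t"
  proof -
    obtain t' where "T t' < l" "t' < t"
      using cInf_lessD[OF ne] \<open>u < t\<close> by (auto simp: u_def)
    then show ?thesis using antimonoD[OF T, of t' t] by simp
  qed
qed

text \<open>
  The value \<open>T (u n)\<close> is compared with \<open>T (u n * y)\<close> for \<open>y\<close> just below and just above 1, where \<open>n * T\<close>
  lies on either side of 1. Regular variation makes the cost of this comparison the factor
  \<open>y powr \<alpha>\<close>, which is as close to 1 as desired; thus a jump of \<open>T\<close> at \<open>u n\<close> is asymptotically
  negligible.
\<close>

lemma regularly_varying_quantile_limits:
  fixes T :: "real \<Rightarrow> real"
  assumes T: "antimono T" and nonneg: "\<And>t. 0 \<le> T t" and T0: "(T \<longlongrightarrow> 0) at_top"
    and \<alpha>: "\<alpha> > 0" and rv: "regularly_varying T (-\<alpha>)"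
  defines "u \<equiv> (\<lambda>n. Inf {t. T t < 1 / real n})"
  shows "filterlim u at_top sequentially"
    and "x > 0 \<Longrightarrow> (\<lambda>n. real n * T (u n * x)) \<longlonglongrightarrow> x powr (-\<alpha>)"
    and "x \<le> 0 \<Longrightarrow> filterlim (\<lambda>n. real n * T (u n * x)) at_top sequentially"
proof -
  have pos: "T t > 0" for t by (rule regularly_varying_imp_pos[OF T nonneg rv])
  have small: "\<forall>\<^sub>F n in sequentially. 0 < 1 / real n \<and> 1 / real n \<le> T s" for s
  proof -
    have "(\<lambda>n. 1 / real n) \<longlonglongrightarrow> 0" by real_asymp
    from order_tendstoD(2)[OF this pos[of s]] eventually_gt_at_top[of 0]
    show ?thesis by eventually_elim simp
  qed
  show u: "filterlim u at_top sequentially"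
    unfolding filterlim_at_top
  proof
    fix s
    show "\<forall>\<^sub>F n in sequentially. s \<le> u n"
      using small[of s]
    proof eventually_elim
      case (elim n)
      then show ?case using quantile_bounds(1)[OF T T0] by (simp add: u_def)
    qed
  qed
  then have u_pos: "\<forall>\<^sub>F n in sequentially. u n > 0"
    by (simp add: filterlim_at_top_dense)
  have ratio: "(\<lambda>n. T (u n * x) / T (u n)) \<longlonglongrightarrow> x powr (-\<alpha>)" if "x > 0" for x
    using filterlim_compose[OF _ u] rv that unfolding regularly_varying_def by blast
  have inv: "(\<lambda>n. T (u n) / T (u n * y)) \<longlonglongrightarrow> y powr \<alpha>" if "y > 0" for y
    using tendsto_inverse[OF ratio[OF that]] that by (simp add: powr_minus)
  have cont: "((\<lambda>y. y powr \<alpha>) \<longlongrightarrow> 1) (at 1 within S)" for S :: "real set"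
    by (rule tendsto_eq_intros refl | simp)+
  have at_quantile: "(\<lambda>n. real n * T (u n)) \<longlonglongrightarrow> 1"
  proof (rule order_tendstoI)
    fix l :: real assume "l < 1"
    with cont[of "{..<1}"] have "\<forall>\<^sub>F y::real in at_left 1. l < y powr \<alpha>"
      by (rule order_tendstoD(1))
    from eventually_happens'[OF _ eventually_conj[OF eventually_at_left_real[OF zero_less_one] this]]
    obtain y :: real where y: "0 < y" "y < 1" "l < y powr \<alpha>" by auto
    show "\<forall>\<^sub>F n in sequentially. l < real n * T (u n)"
      using order_tendstoD(1)[OF inv[OF y(1)] y(3)] u_pos small[of 0]
    proof eventually_elim
      case (elim n)
      then have "1 / real n \<le> T (u n * y)"
        using quantile_bounds(2)[OF T T0, of "1 / real n" 0 "u n * y"] y by (simp add: u_def)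
      then have "T (u n) / T (u n * y) \<le> T (u n) / (1 / real n)"
        using pos elim by (intro divide_left_mono) (auto simp: less_imp_le)
      with elim show ?case by (simp add: mult.commute)
    qed
  next
    fix h :: real assume "1 < h"
    with cont[of "{1<..}"] have "\<forall>\<^sub>F y::real in at_right 1. y powr \<alpha> < h"
      by (rule order_tendstoD(2))
    from eventually_happens'[OF _ eventually_conj[OF eventually_at_right_less this]]
    obtain y :: real where y: "1 < y" "y powr \<alpha> < h" by auto
    have "y > 0" using y by simp
    show "\<forall>\<^sub>F n in sequentially. real n * T (u n) < h"
      using order_tendstoD(2)[OF inv[OF \<open>y > 0\<close>] y(2)] u_pos small[of 0]
    proof eventually_elim
      case (elim n)
      then have "T (u n * y) < 1 / real n"
        using quantile_bounds(3)[OF T T0, of "1 / real n" 0 "u n * y"] y by (simp add: u_def)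
      then have "T (u n) / (1 / real n) \<le> T (u n) / T (u n * y)"
        using pos elim by (intro divide_left_mono) (auto simp: less_imp_le)
      with elim show ?case by (simp add: mult.commute)
    qed
  qed
  have lim: "(\<lambda>n. real n * T (u n * x)) \<longlonglongrightarrow> x powr (-\<alpha>)" if "x > 0" for x
  proof -
    have "(\<lambda>n. real n * T (u n) * (T (u n * x) / T (u n))) \<longlonglongrightarrow> 1 * x powr (-\<alpha>)"
      by (intro tendsto_mult at_quantile ratio that)
    moreover have "T (u n) \<noteq> 0" for n using pos[of "u n"] by simp
    ultimately show ?thesis by simp
  qed
  show "x > 0 \<Longrightarrow> (\<lambda>n. real n * T (u n * x)) \<longlonglongrightarrow> x powr (-\<alpha>)" by (rule lim)
  assume x: "x \<le> 0"
  show "filterlim (\<lambda>n. real n * T (u n * x)) at_top sequentially"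
    unfolding filterlim_at_top_dense
  proof
    fix Z :: real
    \<comment> \<open>A positive argument at which the limit is \<open>\<bar>Z\<bar> + 1\<close>; the tail at \<open>u n * x\<close> is even larger.\<close>
    define y where "y = (\<bar>Z\<bar> + 1) powr (- (1/\<alpha>))"
    have y: "y > 0" by (simp add: y_def)
    have "y powr (-\<alpha>) = \<bar>Z\<bar> + 1" using \<alpha> by (simp add: y_def powr_powr)
    then have "Z < y powr (-\<alpha>)" by simp
    from order_tendstoD(1)[OF lim[OF y] this] u_pos
    show "\<forall>\<^sub>F n in sequentially. Z < real n * T (u n * x)"
    proof eventually_elim
      case (elim n)
      then have "u n * x \<le> u n * y" using x y by (intro mult_left_mono) auto
      from mult_left_mono[OF antimonoD[OF T this], of "real n"] elim show ?case by simp
    qed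
  qed
qed

section \<open>Powers and free iterates in terms of tails\<close>

text \<open>
  The estimates \<open>1 - p \<le> - ln p \<le> (1 - p) / p\<close> squeeze either sequence by the other.
\<close>

lemma tendsto_mult_ln_iff:
  fixes p :: "nat \<Rightarrow> real"
  assumes p: "\<And>n. p n \<le> 1" and p1: "p \<longlonglongrightarrow> 1"
  shows "(\<lambda>n. real n * (1 - p n)) \<longlonglongrightarrow> \<tau> \<longleftrightarrow> (\<lambda>n. real n * ln (p n)) \<longlonglongrightarrow> -\<tau>"
proof
  have pos: "\<forall>\<^sub>F n in sequentially. p n > 0"
    using p1 by (rule order_tendstoD) simp
  have bounds: "\<forall>\<^sub>F n in sequentially. real n * (1 - p n) \<le> - (real n * ln (p n)) \<and>
      p n * - (real n * ln (p n)) \<le> real n * (1 - p n)"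
    using pos
  proof eventually_elim
    case (elim n)
    have "ln (p n) \<le> p n - 1" using elim by (rule ln_le_minus_one)
    from mult_left_mono[OF this, of "real n"]
    have 1: "real n * (1 - p n) \<le> - (real n * ln (p n))" by (simp add: algebra_simps)
    have "- ln (p n) \<le> inverse (p n) - 1"
      using ln_le_minus_one[of "inverse (p n)"] elim by (simp add: ln_inverse)
    then have "p n * (- ln (p n)) \<le> 1 - p n"
      using elim by (simp add: field_simps)
    from mult_left_mono[OF this, of "real n"] 1
    show ?case by (simp add: algebra_simps)
  qed
  {
    assume L: "(\<lambda>n. real n * (1 - p n)) \<longlonglongrightarrow> \<tau>"
    have "(\<lambda>n. - (real n * ln (p n))) \<longlonglongrightarrow> \<tau>"
    proof (rule tendsto_sandwich[OF _ _ L])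
      show "(\<lambda>n. real n * (1 - p n) / p n) \<longlonglongrightarrow> \<tau>"
        using tendsto_divide[OF L p1] by simp
      show "\<forall>\<^sub>F n in sequentially. real n * (1 - p n) \<le> - (real n * ln (p n))"
        using bounds by eventually_elim simp
      show "\<forall>\<^sub>F n in sequentially. - (real n * ln (p n)) \<le> real n * (1 - p n) / p n"
        using bounds pos by eventually_elim (simp add: field_simps)
    qed
    then show "(\<lambda>n. real n * ln (p n)) \<longlonglongrightarrow> -\<tau>" by (simp add: tendsto_minus_cancel_left)
  next
    assume "(\<lambda>n. real n * ln (p n)) \<longlonglongrightarrow> -\<tau>"
    then have L: "(\<lambda>n. - (real n * ln (p n))) \<longlonglongrightarrow> \<tau>" by (simp add: tendsto_minus_cancel_left)
    show "(\<lambda>n. real n * (1 - p n)) \<longlonglongrightarrow> \<tau>"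
    proof (rule tendsto_sandwich[OF _ _ _ L])
      show "(\<lambda>n. p n * - (real n * ln (p n))) \<longlonglongrightarrow> \<tau>"
        using tendsto_mult[OF p1 L] by simp
    qed (use bounds in \<open>eventually_elim, simp\<close>)+
  }
qed

text \<open>
  Either limit forces \<open>p n \<longlonglongrightarrow> 1\<close>, because \<open>n * (1 - p n)\<close> or \<open>n * ln (p n)\<close> stays bounded; after that
  the claim is the previous lemma under the exponential.
\<close>

lemma tendsto_power_exp_iff:
  fixes p :: "nat \<Rightarrow> real"
  assumes p: "\<And>n. 0 \<le> p n" "\<And>n. p n \<le> 1"
  shows "(\<lambda>n. p n ^ n) \<longlonglongrightarrow> exp (-\<tau>) \<longleftrightarrow> (\<lambda>n. real n * (1 - p n)) \<longlonglongrightarrow> \<tau>"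
proof
  assume L: "(\<lambda>n. p n ^ n) \<longlonglongrightarrow> exp (-\<tau>)"
  have "\<forall>\<^sub>F n in sequentially. p n ^ n > 0"
    using L by (rule order_tendstoD) simp
  then have pos: "\<forall>\<^sub>F n in sequentially. p n > 0"
    using eventually_gt_at_top[of 0]
  proof eventually_elim
    case (elim n)
    then show ?case using p(1)[of n] by (cases "p n = 0") (auto simp: power_0_left)
  qed
  have "(\<lambda>n. ln (p n ^ n)) \<longlonglongrightarrow> ln (exp (-\<tau>))"
    using L by (intro tendsto_ln) auto
  then have "(\<lambda>n. ln (p n ^ n)) \<longlonglongrightarrow> -\<tau>" by simp
  then have ln: "(\<lambda>n. real n * ln (p n)) \<longlonglongrightarrow> -\<tau>"
    by (rule Lim_transform_eventually) (use pos in eventually_elim, simp add: ln_realpow)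
  have "(\<lambda>n. exp (real n * ln (p n) * (1 / real n))) \<longlonglongrightarrow> exp (-\<tau> * 0)"
    by (intro tendsto_intros ln)
  then have "(\<lambda>n. exp (real n * ln (p n) * (1 / real n))) \<longlonglongrightarrow> 1" by simp
  then have "p \<longlonglongrightarrow> 1"
    by (rule Lim_transform_eventually)
      (use pos eventually_gt_at_top[of 0] in eventually_elim, simp)
  with ln show "(\<lambda>n. real n * (1 - p n)) \<longlonglongrightarrow> \<tau>"
    using tendsto_mult_ln_iff p by blast
next
  assume L: "(\<lambda>n. real n * (1 - p n)) \<longlonglongrightarrow> \<tau>"
  have "(\<lambda>n. 1 - real n * (1 - p n) * (1 / real n)) \<longlonglongrightarrow> 1 - \<tau> * 0"
    by (intro tendsto_intros L)
  then have "(\<lambda>n. 1 - real n * (1 - p n) * (1 / real n)) \<longlonglongrightarrow> 1" by simp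
  then have p1: "p \<longlonglongrightarrow> 1"
    by (rule Lim_transform_eventually)
      (use eventually_gt_at_top[of 0] in eventually_elim, simp)
  then have pos: "\<forall>\<^sub>F n in sequentially. p n > 0"
    by (rule order_tendstoD) simp
  have "(\<lambda>n. exp (real n * ln (p n))) \<longlonglongrightarrow> exp (-\<tau>)"
    using L tendsto_mult_ln_iff[OF p(2) p1] by (intro tendsto_exp) blast
  then show "(\<lambda>n. p n ^ n) \<longlonglongrightarrow> exp (-\<tau>)"
    by (rule Lim_transform_eventually)
      (use pos in eventually_elim, simp add: exp_of_nat_mult)
qed

lemma tail_of_distribution_function:
  assumes "distribution_function F"
  shows "antimono (tail F)" "0 \<le> tail F t" "tail F t \<le> 1" "(tail F \<longlongrightarrow> 0) at_top"
proof -
  obtain M where M: "real_distribution M" and F: "F = cdf M"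
    using assms by (auto simp: distribution_function_def)
  interpret real_distribution M by (fact M)
  show "antimono (tail F)"
    by (auto simp: antimono_def tail_def F intro: cdf_nondecreasing)
  show "0 \<le> tail F t" "tail F t \<le> 1"
    using distribution_function_bounds[OF assms] by (auto simp: tail_def)
  have "((\<lambda>t. 1 - F t) \<longlongrightarrow> 1 - 1) at_top"
    unfolding F by (intro tendsto_intros cdf_lim_at_top_prob)
  then show "(tail F \<longlongrightarrow> 0) at_top" by (simp add: tail_def[abs_def])
qed

text \<open>
  Where the Pareto limit is positive, the free iterates are eventually positive as well, so the
  truncation at 0 is inactive and they equal \<open>1 - n * tail F\<close>.
\<close>

lemma free_max_normalization_imp_tail_normalized:
  assumes \<alpha>: "\<alpha> > 0" and F: "distribution_function F"
    and norm: "free_max_normalization F (pareto_df \<alpha>) a b"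
  shows "tail_normalized (tail F) \<alpha> a b"
  unfolding tail_normalized_def
proof (intro conjI allI impI)
  show "a n > 0" if "n \<ge> 1" for n
    using norm that by (simp add: free_max_normalization_def)
  fix x :: real assume x: "x > 1"
  have lt1: "y powr (-\<alpha>) < 1" if "y > 1" for y
    using powr_less_mono2_neg[of "-\<alpha>" 1 y] \<alpha> that by simp
  have "\<forall>\<^sub>F y in nhds x. y > 1"
    using x eventually_nhds_in_open[of "{1<..}" x] by simp
  then have eq: "\<forall>\<^sub>F y in nhds x. pareto_df \<alpha> y = 1 - y powr (-\<alpha>)"
    by eventually_elim (use lt1 in \<open>force simp: pareto_df_def\<close>)
  have "isCont (\<lambda>y. 1 - y powr (-\<alpha>)) x"
    using x by (intro continuous_intros) auto
  then have "isCont (pareto_df \<alpha>) x"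
    using isCont_cong[OF eq] by simp
  then have L: "(\<lambda>n. upper_free_conv_power F n (a n * x + b n)) \<longlonglongrightarrow> pareto_df \<alpha> x"
    using norm by (simp add: free_max_normalization_def)
  have px: "pareto_df \<alpha> x = 1 - x powr (-\<alpha>)" using eq by (rule eventually_nhds_x_imp_x)
  have "\<forall>\<^sub>F n in sequentially. upper_free_conv_power F n (a n * x + b n) > 0"
    using L by (rule order_tendstoD) (use lt1[OF x] px in simp)
  then have "\<forall>\<^sub>F n in sequentially. 1 - upper_free_conv_power F n (a n * x + b n) =
      real n * tail F (a n * x + b n)"
    by eventually_elim (auto simp: upper_free_conv_power_eq[OF F] tail_def algebra_simps)
  moreover have "(\<lambda>n. 1 - upper_free_conv_power F n (a n * x + b n)) \<longlonglongrightarrow> 1 - pareto_df \<alpha> x"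
    by (intro tendsto_intros L)
  ultimately show "(\<lambda>n. real n * tail F (a n * x + b n)) \<longlonglongrightarrow> x powr (-\<alpha>)"
    using Lim_transform_eventually px by fastforce
qed

lemma classical_max_normalization_imp_tail_normalized:
  assumes F: "distribution_function F"
    and norm: "classical_max_normalization F (frechet_df \<alpha>) a b"
  shows "tail_normalized (tail F) \<alpha> a b"
  unfolding tail_normalized_def
proof (intro conjI allI impI)
  show "a n > 0" if "n \<ge> 1" for n
    using norm that by (simp add: classical_max_normalization_def)
  fix x :: real assume x: "x > 1"
  have "\<forall>\<^sub>F y in nhds x. y > 0"
    using x eventually_nhds_in_open[of "{0<..}" x] by simp
  then have eq: "\<forall>\<^sub>F y in nhds x. frechet_df \<alpha> y = exp (- (y powr (-\<alpha>)))"
    by eventually_elim (simp add: frechet_df_def)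
  have "isCont (\<lambda>y. exp (- (y powr (-\<alpha>)))) x"
    using x by (intro continuous_intros) auto
  then have "isCont (frechet_df \<alpha>) x"
    using isCont_cong[OF eq] by simp
  then have "(\<lambda>n. F (a n * x + b n) ^ n) \<longlonglongrightarrow> exp (- (x powr (-\<alpha>)))"
    using norm x unfolding classical_max_normalization_def by (auto simp: frechet_df_def[of _ x])
  then show "(\<lambda>n. real n * tail F (a n * x + b n)) \<longlonglongrightarrow> x powr (-\<alpha>)"
    using tendsto_power_exp_iff[of "\<lambda>n. F (a n * x + b n)"] distribution_function_bounds[OF F]
    by (simp add: tail_def)
qed

text \<open>
  For \<open>x > 0\<close> both limits are continuous images of the tail limit. For \<open>x \<le> 0\<close> divergence of the
  tails makes the free iterates eventually 0 and sends the powers to 0 through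
  \<open>F t ^ n \<le> exp (- n * tail F t)\<close>.
\<close>

lemma tail_limits_imp_max_normalizations:
  assumes F: "distribution_function F" and a: "\<And>n. n \<ge> 1 \<Longrightarrow> a n > 0"
    and lim: "\<And>x. x > 0 \<Longrightarrow> (\<lambda>n. real n * tail F (a n * x + b n)) \<longlonglongrightarrow> x powr (-\<alpha>)"
    and inf: "\<And>x. x \<le> 0 \<Longrightarrow> filterlim (\<lambda>n. real n * tail F (a n * x + b n)) at_top sequentially"
  shows "free_max_normalization F (pareto_df \<alpha>) a b"
    and "classical_max_normalization F (frechet_df \<alpha>) a b"
proof -
  have free: "upper_free_conv_power F n t = max (1 - real n * tail F t) 0" for n t
    by (simp add: upper_free_conv_power_eq[OF F] tail_def algebra_simps)
  have "(\<lambda>n. upper_free_conv_power F n (a n * x + b n)) \<longlonglongrightarrow> pareto_df \<alpha> x" for x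
  proof (cases "x > 0")
    case True
    then show ?thesis
      unfolding free pareto_df_def by (auto intro!: tendsto_intros lim)
  next
    case False
    then have "\<forall>\<^sub>F n in sequentially. real n * tail F (a n * x + b n) \<ge> 1"
      using inf[of x] by (simp add: filterlim_at_top)
    then have "\<forall>\<^sub>F n in sequentially. upper_free_conv_power F n (a n * x + b n) = 0"
      by eventually_elim (simp add: free)
    then show ?thesis using False by (simp add: pareto_df_def tendsto_eventually)
  qed
  with a show "free_max_normalization F (pareto_df \<alpha>) a b"
    by (simp add: free_max_normalization_def)
  have "(\<lambda>n. F (a n * x + b n) ^ n) \<longlonglongrightarrow> frechet_df \<alpha> x" for x
  proof (cases "x > 0")
    case True
    then show ?thesis
      using lim[OF True] distribution_function_bounds[OF F]
        tendsto_power_exp_iff[of "\<lambda>n. F (a n * x + b n)"]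
      by (simp add: frechet_df_def tail_def)
  next
    case False
    have le: "F t ^ n \<le> exp (- (real n * tail F t))" for n t
    proof -
      have "F t \<le> exp (- tail F t)"
        using exp_ge_add_one_self[of "- tail F t"] by (simp add: tail_def)
      then have "F t ^ n \<le> exp (- tail F t) ^ n"
        using distribution_function_bounds[OF F] by (intro power_mono)
      then show ?thesis by (simp add: exp_of_nat_mult [symmetric])
    qed
    have "(\<lambda>n. exp (- (real n * tail F (a n * x + b n)))) \<longlonglongrightarrow> 0"
      using inf[of x] False
      by (intro filterlim_compose[OF exp_at_bot] filterlim_compose[OF filterlim_uminus_at_bot_at_top]) auto
    then have "(\<lambda>n. F (a n * x + b n) ^ n) \<longlonglongrightarrow> 0"
      by (rule tendsto_sandwich[OF _ _ tendsto_const, rotated 2])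
        (use le distribution_function_bounds[OF F] in \<open>auto intro!: always_eventually\<close>)
    then show ?thesis using False by (simp add: frechet_df_def)
  qed
  with a show "classical_max_normalization F (frechet_df \<alpha>) a b"
    by (simp add: classical_max_normalization_def)
qed

lemma regularly_varying_imp_quantile_normalizations:
  assumes \<alpha>: "\<alpha> > 0" and F: "distribution_function F" and rv: "regularly_varying (tail F) (-\<alpha>)"
  shows "\<exists>a b. (\<forall>\<^sub>F n in sequentially. a n = tail_quantile F n \<and> b n = 0) \<and>
    free_max_normalization F (pareto_df \<alpha>) a b \<and>
    classical_max_normalization F (frechet_df \<alpha>) a b"
proof -
  note q = regularly_varying_quantile_limits[OF tail_of_distribution_function(1,2,4)[OF F] \<alpha> rv,
      folded tail_quantile_def]
  \<comment> \<open>Normalizing constants must be positive from \<open>n = 1\<close> on, which quantiles are only eventually.\<close>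
  define a where "a n = (if tail_quantile F n > 0 then tail_quantile F n else 1)" for n
  have "\<forall>\<^sub>F n in sequentially. tail_quantile F n > 0"
    using q(1) by (simp add: filterlim_at_top_dense)
  then have a: "\<forall>\<^sub>F n in sequentially. tail_quantile F n = a n"
    by eventually_elim (simp add: a_def)
  have eq: "\<forall>\<^sub>F n in sequentially. real n * tail F (tail_quantile F n * x) =
      real n * tail F (a n * x + 0)" for x
    using a by eventually_elim simp
  have "(\<lambda>n. real n * tail F (a n * x + 0)) \<longlonglongrightarrow> x powr (-\<alpha>)" if "x > 0" for x
    using q(2)[OF that] eq by (rule Lim_transform_eventually)
  moreover have "filterlim (\<lambda>n. real n * tail F (a n * x + 0)) at_top sequentially" if "x \<le> 0" for x
    using q(3)[OF that] filterlim_cong[OF refl refl eq] by blast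
  moreover have "a n > 0" for n by (simp add: a_def)
  ultimately have "free_max_normalization F (pareto_df \<alpha>) a (\<lambda>_. 0)"
    "classical_max_normalization F (frechet_df \<alpha>) a (\<lambda>_. 0)"
    using tail_limits_imp_max_normalizations[OF F, of a "\<lambda>_. 0"] by blast+
  moreover have "\<forall>\<^sub>F n in sequentially. a n = tail_quantile F n \<and> (0::real) = 0"
    using a by eventually_elim simp
  ultimately show ?thesis by (intro exI[of _ a] exI[of _ "\<lambda>_. 0"] conjI)
qed

section \<open>Equivalence of the two domains of attraction\<close>

theorem theorem6p12:
  fixes \<alpha> :: real and F :: "real \<Rightarrow> real"
  assumes "\<alpha> > 0" and "distribution_function F"
  shows "(in_free_max_domain F (pareto_df \<alpha>) \<longleftrightarrow> in_classical_max_domain F (frechet_df \<alpha>)) \<and>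
    (in_classical_max_domain F (frechet_df \<alpha>) \<longleftrightarrow> regularly_varying (tail F) (-\<alpha>)) \<and>
    (regularly_varying (tail F) (-\<alpha>) \<longrightarrow>
      (\<forall>t. tail F t > 0) \<and>
      (\<exists>a b. (\<forall>\<^sub>F n in sequentially. a n = tail_quantile F n \<and> b n = 0) \<and>
        free_max_normalization F (pareto_df \<alpha>) a b \<and>
        classical_max_normalization F (frechet_df \<alpha>) a b))"
proof -
  note tail = tail_of_distribution_function[OF assms(2)]
  have rv: "regularly_varying (tail F) (-\<alpha>)" if "tail_normalized (tail F) \<alpha> a b" for a b
    using tail_normalized_imp_regularly_varying[OF tail(1) assms(1) that tail(4)] .
  have "regularly_varying (tail F) (-\<alpha>)" if "in_free_max_domain F (pareto_df \<alpha>)"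
    using that free_max_normalization_imp_tail_normalized[OF assms] rv
    unfolding in_free_max_domain_def by blast
  moreover have "regularly_varying (tail F) (-\<alpha>)" if "in_classical_max_domain F (frechet_df \<alpha>)"
    using that classical_max_normalization_imp_tail_normalized[OF assms(2)] rv
    unfolding in_classical_max_domain_def by blast
  moreover note regularly_varying_imp_quantile_normalizations[OF assms]
    regularly_varying_imp_pos[OF tail(1,2)]
  ultimately show ?thesis
    unfolding in_free_max_domain_def in_classical_max_domain_def by blast
qed

end
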